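(* Let $H=(S,\circ)$ and $K=(T,\circ)$ be groups endowed with affine structures $\sigma^S$ and $\sigma^T$, respectively, and let $(S,T,\alpha,\beta)$ be a matched product system of groups. Write $\sigma_a:=\sigma^S_a$ for $a\in S$ and $\sigma_u:=\sigma^T_u$ for $u\in T$ (so in an identity between maps of $S$, $\sigma_0$ means $\sigma^S_0$, and in an identity between maps of $T$ it means $\sigma^T_0$). Suppose that for all $a,b\in S$ and $u,v\in T$: (I) $\sigma_0\alpha_u=\alpha_u\sigma_0$ and $\sigma_0\beta_a=\beta_a\sigma_0$; (II) $\sigma_{\alpha_u(a)}=\sigma_a$ and $\sigma_{\beta_a(u)}=\sigma_u$; (III) $\alpha_{\bar v}\,\sigma_{\rho_b(a^-)}=\sigma_{\rho_b(a^-)}\,\alpha_{\overline V}$ and $\beta_{\bar b}\,\sigma_{\rho_v(u^-)}=\sigma_{\rho_v(u^-)}\,\beta_{\overline B}$, where $\bar v=\beta_b^{-1}(v)$, $\bar b=\alpha_v^{-1}(b)$, $\overline V=\beta^{-1}_{\sigma_a(b)}\sigma_u(v)$, $\overline B=\alpha^{-1}_{\sigma_u(v)}\sigma_a(b)$, $\rho_b(a^-)=\sigma_a(b)^-\circ a^-\circ b$ and $\rho_v(u^-)=\sigma_u(v)^-\circ u^-\circ v$. Then the map $\sigma:=\sigma^S\times\sigma^T$, i.e. $\sigma_{(a,u)}(b,v)=(\sigma_a(b),\sigma_u(v))$ for all $(a,u),(b,v)\in S\times T$, is an affine structure on the group $H\bowtie_{\alpha,\beta}K$.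
   Context: For a group $(B,\circ)$, $0$ denotes its identity and $a^-$ the inverse of $a$. $B^B$ is the monoid (under composition) of all maps $B\to B$ and $\mathrm{Sym}_B$ is the symmetric group on $B$. For a map $\sigma:B\to B^B$ write $\sigma_a:=\sigma(a)$, and similarly for $\alpha,\beta$; juxtaposition of maps is composition. An affine structure on a group $(B,\circ)$ is a map $\sigma:B\to B^B$ that is a semigroup anti-homomorphism, i.e. $\sigma_{a\circ b}=\sigma_b\sigma_a$ for all $a,b\in B$ (it is not required that $\sigma_0=\mathrm{id}_B$), such that $\sigma_a(b\circ\sigma_b(c))=\sigma_a(b)\circ\sigma_{\sigma_a(b)}\sigma_a(c)$ for all $a,b,c\in B$. A matched product system of groups $(S,T,\alpha,\beta)$ consists of groups $H=(S,\circ)$, $K=(T,\circ)$ and group homomorphisms $\alpha:K\to\mathrm{Sym}_S$, $\beta:H\to\mathrm{Sym}_T$ such that, for all $a,b\in S$, $u,v\in T$, $$\alpha_u(\alpha_u^{-1}(a)\circ b)=a\circ\alpha_{\beta_a^{-1}(u)}(b),\qquad \beta_a(\beta_a^{-1}(u)\circ v)=u\circ\beta_{\alpha_u^{-1}(a)}(v).$$ Then $H\bowtie_{\alpha,\beta}K$ denotes the group on $S\times T$ with operation $$(a,u)\circ(b,v)=\bigl(a\circ\alpha_{\beta_a^{-1}(u)}(b),\;u\circ\beta_{\alpha_u^{-1}(a)}(v)\bigr),$$ whose identity is $(0,0)$. For an affine structure $\sigma$ on $(B,\circ)$, $\rho_b(a):=\sigma_{a^-}(b)^-\circ a\circ b$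 for $a,b\in B$. *)

theory Defs
  imports "HOL-Algebra.Bij"
begin

text \<open>
  A self-map of a set \<open>B\<close> is represented by an element of \<open>B \<rightarrow>\<^sub>E B\<close>, which makes equality
  of maps literal equality; composition of such maps is \<^const>\<open>compose\<close> on \<open>B\<close>, and the
  symmetric group on \<open>B\<close> is \<^const>\<open>BijGroup\<close> on \<open>B\<close>.
\<close>

locale affine_structure = group G for G (structure) +
  fixes \<sigma> :: "'a \<Rightarrow> 'a \<Rightarrow> 'a"
  assumes maps: "\<sigma> \<in> carrier G \<rightarrow> (carrier G \<rightarrow>\<^sub>E carrier G)"
    and anti_hom: "\<lbrakk>a \<in> carrier G; b \<in> carrier G\<rbrakk> \<Longrightarrow>
      \<sigma> (a \<otimes> b) = compose (carrier G) (\<sigma> b) (\<sigma> a)"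
    and affine: "\<lbrakk>a \<in> carrier G; b \<in> carrier G; c \<in> carrier G\<rbrakk> \<Longrightarrow>
      \<sigma> a (b \<otimes> \<sigma> b c) = \<sigma> a b \<otimes> \<sigma> (\<sigma> a b) (\<sigma> a c)"

text \<open>\<open>rho G \<sigma> b a\<close> stands for \<open>\<rho>\<^sub>b(a)\<close>: the index is the first argument after \<open>\<sigma>\<close>.\<close>

definition rho :: "('a, 'm) monoid_scheme \<Rightarrow> ('a \<Rightarrow> 'a \<Rightarrow> 'a) \<Rightarrow> 'a \<Rightarrow> 'a \<Rightarrow> 'a" where
  "rho G \<sigma> b a = inv\<^bsub>G\<^esub> (\<sigma> (inv\<^bsub>G\<^esub> a) b) \<otimes>\<^bsub>G\<^esub> a \<otimes>\<^bsub>G\<^esub> b"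

text \<open>Inverses of permutations are written with \<^const>\<open>inv_into\<close> on the carrier.\<close>

locale matched_product_system = H: group H + K: group K
  for H :: "('a, 'm) monoid_scheme" and K :: "('b, 'n) monoid_scheme" +
  fixes \<alpha> :: "'b \<Rightarrow> 'a \<Rightarrow> 'a" and \<beta> :: "'a \<Rightarrow> 'b \<Rightarrow> 'b"
  assumes \<alpha>_hom: "\<alpha> \<in> hom K (BijGroup (carrier H))"
    and \<beta>_hom: "\<beta> \<in> hom H (BijGroup (carrier K))"
    and \<alpha>_compat: "\<lbrakk>a \<in> carrier H; b \<in> carrier H; u \<in> carrier K\<rbrakk> \<Longrightarrow>
      \<alpha> u (inv_into (carrier H) (\<alpha> u) a \<otimes>\<^bsub>H\<^esub> b)
        = a \<otimes>\<^bsub>H\<^esub> \<alpha> (inv_into (carrier K) (\<beta> a) u) b"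
    and \<beta>_compat: "\<lbrakk>a \<in> carrier H; u \<in> carrier K; v \<in> carrier K\<rbrakk> \<Longrightarrow>
      \<beta> a (inv_into (carrier K) (\<beta> a) u \<otimes>\<^bsub>K\<^esub> v)
        = u \<otimes>\<^bsub>K\<^esub> \<beta> (inv_into (carrier H) (\<alpha> u) a) v"

definition matched_product ::
  "('a, 'm) monoid_scheme \<Rightarrow> ('b, 'n) monoid_scheme \<Rightarrow> ('b \<Rightarrow> 'a \<Rightarrow> 'a) \<Rightarrow> ('a \<Rightarrow> 'b \<Rightarrow> 'b)
    \<Rightarrow> ('a \<times> 'b) monoid" where
  "matched_product H K \<alpha> \<beta> =
    \<lparr>carrier = carrier H \<times> carrier K,
     mult = (\<lambda>(a, u) (b, v).
       (a \<otimes>\<^bsub>H\<^esub> \<alpha> (inv_into (carrier K) (\<beta> a) u) b,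
        u \<otimes>\<^bsub>K\<^esub> \<beta> (inv_into (carrier H) (\<alpha> u) a) v)),
     one = (\<one>\<^bsub>H\<^esub>, \<one>\<^bsub>K\<^esub>)\<rparr>"

definition prod_structure ::
  "('a, 'm) monoid_scheme \<Rightarrow> ('b, 'n) monoid_scheme \<Rightarrow> ('a \<Rightarrow> 'a \<Rightarrow> 'a) \<Rightarrow> ('b \<Rightarrow> 'b \<Rightarrow> 'b)
    \<Rightarrow> 'a \<times> 'b \<Rightarrow> 'a \<times> 'b \<Rightarrow> 'a \<times> 'b" where
  "prod_structure H K \<sigma>S \<sigma>T =
    (\<lambda>(a, u). \<lambda>(b, v)\<in>carrier H \<times> carrier K. (\<sigma>S a b, \<sigma>T u v))"

end

theory Submission
  imports Defs
begin

text \<open>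
  Associativity of the matched product amounts to the cocycle rule
  \<open>\<beta>\<^sub>c\<^sup>-\<^sup>1 (x v) = \<beta>\<^sub>c\<^sup>-\<^sup>1 x \<cdot> \<beta>\<^sub>d\<^sup>-\<^sup>1 v\<close> with \<open>d = \<alpha>\<^sub>x\<^sup>-\<^sup>1 c\<close>, and right inverses can be read off
  from the definition of the product. The affine identity may be checked on each factor.
  There, as \<open>\<sigma>\<^sub>0\<close> acts as the identity on the image of each \<open>\<sigma>\<^sub>b\<close> and commutes with
  \<open>p = \<alpha>\<^bsub>v'\<^esub>\<close>, where \<open>v' = \<beta>\<^sub>b\<^sup>-\<^sup>1 v\<close>, the element \<open>p (\<sigma>\<^sub>b c)\<close> has the form \<open>\<sigma>\<^sub>b d\<close>, so the affine
  identity of the factor applies. What remains follows from \<open>\<sigma>\<^sub>b = \<sigma>\<^sub>r \<sigma>\<^bsub>s\<^esub> \<sigma>\<^sub>a\<close> for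
  \<open>s = \<sigma>\<^sub>a b\<close> and \<open>r = \<rho>\<^sub>b (a\<^sup>-)\<close>, because \<open>p\<close> can be moved past \<open>\<sigma>\<^sub>r\<close>.
\<close>

section \<open>Affine structures and a twisted form of their identity\<close>

context affine_structure
begin

lemma \<sigma>_closed [simp]:
  "\<lbrakk>a \<in> carrier G; x \<in> carrier G\<rbrakk> \<Longrightarrow> \<sigma> a x \<in> carrier G"
  using maps by (auto simp: Pi_iff PiE_iff)

lemma \<sigma>_mult:
  "\<lbrakk>a \<in> carrier G; b \<in> carrier G; x \<in> carrier G\<rbrakk> \<Longrightarrow> \<sigma> (a \<otimes> b) x = \<sigma> b (\<sigma> a x)"
  by (simp add: anti_hom compose_eq)

text \<open>Follows from \<open>a \<otimes> \<one> = a\<close>. It stands in for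
  \<open>\<sigma> \<one> = id\<close>, which may fail.\<close>

lemma \<sigma>_one_\<sigma>:
  "\<lbrakk>a \<in> carrier G; x \<in> carrier G\<rbrakk> \<Longrightarrow> \<sigma> \<one> (\<sigma> a x) = \<sigma> a x"
  using \<sigma>_mult[of a \<one> x] by simp

text \<open>The maps \<open>p\<close> and \<open>q\<close> abstract the two permutations in (III),
  so that one argument serves both factors. Taking both to be the identity gives back the affine
  identity.\<close>

lemma affine_twisted:
  assumes abc: "a \<in> carrier G" "b \<in> carrier G" "c \<in> carrier G"
    and p: "p \<in> carrier G \<rightarrow> carrier G" and q: "q \<in> carrier G \<rightarrow> carrier G"
    and p_comm: "\<And>x. x \<in> carrier G \<Longrightarrow> \<sigma> \<one> (p x) = p (\<sigma> \<one> x)"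
    and q_comm: "\<And>x. x \<in> carrier G \<Longrightarrow> \<sigma> \<one> (q x) = q (\<sigma> \<one> x)"
    and twist: "\<And>x. x \<in> carrier G \<Longrightarrow>
      p (\<sigma> (rho G \<sigma> b (inv a)) x) = \<sigma> (rho G \<sigma> b (inv a)) (q x)"
  shows "\<sigma> a (b \<otimes> p (\<sigma> b c)) = \<sigma> a b \<otimes> q (\<sigma> (\<sigma> a b) (\<sigma> a c))"
proof -
  define s where "s = \<sigma> a b"
  define r where "r = rho G \<sigma> b (inv a)"
  define z where "z = \<sigma> s (\<sigma> a c)"
  have s [simp]: "s \<in> carrier G" using abc by (simp add: s_def)
  have r_eq: "r = inv s \<otimes> inv a \<otimes> b" using abc by (simp add: r_def rho_def s_def)
  have r [simp]: "r \<in> carrier G" using abc by (simp add: r_eq)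
  have z [simp]: "z \<in> carrier G" using abc by (simp add: z_def)
  have b_eq: "b = a \<otimes> s \<otimes> r"
    using abc inv_solve_left[of r "a \<otimes> s" b] by (simp add: r_eq inv_mult_group)
  \<comment> \<open>The anti-homomorphism rule turns this into \<open>\<sigma> (inv r) x = \<sigma>
    s (\<sigma> a (\<sigma> (inv b) x))\<close>.\<close>
  have inv_r: "inv r = inv b \<otimes> (a \<otimes> s)"
    using abc by (simp add: r_eq inv_mult_group m_assoc)
  have pc: "p x \<in> carrier G" and qc: "q x \<in> carrier G" if "x \<in> carrier G" for x
    using p q that by auto
  have \<sigma>b: "\<sigma> b c = \<sigma> r z"
    unfolding z_def by (subst b_eq) (use abc in \<open>simp add: \<sigma>_mult\<close>)
  \<comment> \<open>Since \<open>inv b \<otimes> b = \<one>\<close>, applying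
    \<open>\<sigma> b\<close> to \<open>d\<close> gives
    \<open>\<sigma> \<one> (p (\<sigma> b c))\<close>, which is \<open>p (\<sigma> b c)\<close> by
    \<open>p_comm\<close>.\<close>
  define d where "d = \<sigma> (inv b) (p (\<sigma> b c))"
  have d: "d \<in> carrier G" using abc by (simp add: d_def pc)
  have "p (\<sigma> b c) = \<sigma> \<one> (p (\<sigma> b c))"
    using abc by (simp add: p_comm \<sigma>_one_\<sigma>)
  also have "\<dots> = \<sigma> b d"
    using abc \<sigma>_mult[of "inv b" b "p (\<sigma> b c)"] by (simp add: d_def pc)
  finally have "\<sigma> a (b \<otimes> p (\<sigma> b c)) = s \<otimes> \<sigma> s (\<sigma> a d)"
    using abc d by (simp add: affine s_def)
  also have "\<sigma> s (\<sigma> a d) = \<sigma> (inv r) (p (\<sigma> b c))"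
    using abc by (simp add: inv_r d_def \<sigma>_mult pc)
  also have "\<dots> = \<sigma> (inv r) (\<sigma> r (q z))"
    using twist[of z] by (simp add: \<sigma>b flip: r_def)
  \<comment> \<open>From \<open>r \<otimes> inv r = \<one>\<close>. The remaining
    \<open>\<sigma> \<one>\<close> commutes with \<open>q\<close> and fixes \<open>z\<close>, a
    value of \<open>\<sigma> s\<close>.\<close>
  also have "\<dots> = \<sigma> \<one> (q z)"
    using \<sigma>_mult[of r "inv r" "q z"] by (simp add: qc)
  also have "\<dots> = q z"
    using abc by (simp add: q_comm z_def \<sigma>_one_\<sigma>)
  finally show ?thesis by (simp add: s_def z_def)
qed

end

section \<open>The two actions by permutations\<close>

context matched_product_system
begin

text \<open>The axioms are symmetric in the two factors, so each fact about \<open>\<alpha>\<close>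
  on \<open>H\<close> has a mirror image for \<open>\<beta>\<close> on \<open>K\<close>.\<close>

lemma matched_product_system_swap: "matched_product_system K H \<beta> \<alpha>"
  by unfold_locales (rule \<beta>_hom \<alpha>_hom \<beta>_compat \<alpha>_compat; assumption)+

lemma \<alpha>_bij: "u \<in> carrier K \<Longrightarrow> bij_betw (\<alpha> u) (carrier H) (carrier H)"
  using hom_in_carrier[OF \<alpha>_hom, of u] by (simp add: BijGroup_def Bij_def)

lemma \<alpha>_closed [simp]: "\<lbrakk>u \<in> carrier K; a \<in> carrier H\<rbrakk> \<Longrightarrow> \<alpha> u a \<in> carrier H"
  using \<alpha>_bij bij_betwE by blast

lemma inv_\<alpha>_closed [simp]:
  "\<lbrakk>u \<in> carrier K; a \<in> carrier H\<rbrakk> \<Longrightarrow> inv_into (carrier H) (\<alpha> u) a \<in> carrier H"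
  using \<alpha>_bij by (metis bij_betw_imp_surj_on inv_into_into)

lemma \<alpha>_inv_\<alpha> [simp]:
  "\<lbrakk>u \<in> carrier K; a \<in> carrier H\<rbrakk> \<Longrightarrow> \<alpha> u (inv_into (carrier H) (\<alpha> u) a) = a"
  by (rule bij_betw_inv_into_right[OF \<alpha>_bij])

lemma inv_\<alpha>_\<alpha> [simp]:
  "\<lbrakk>u \<in> carrier K; a \<in> carrier H\<rbrakk> \<Longrightarrow> inv_into (carrier H) (\<alpha> u) (\<alpha> u a) = a"
  by (rule bij_betw_inv_into_left[OF \<alpha>_bij])

lemma inv_\<alpha>_eqI:
  "\<lbrakk>u \<in> carrier K; a \<in> carrier H; \<alpha> u a = b\<rbrakk> \<Longrightarrow> inv_into (carrier H) (\<alpha> u) b = a"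
  by auto

lemma \<alpha>_mult:
  assumes "u \<in> carrier K" "v \<in> carrier K" "a \<in> carrier H"
  shows "\<alpha> (u \<otimes>\<^bsub>K\<^esub> v) a = \<alpha> u (\<alpha> v a)"
  using assms hom_mult[OF \<alpha>_hom] hom_in_carrier[OF \<alpha>_hom]
  by (simp add: BijGroup_def compose_eq)

lemma \<alpha>_one [simp]: "a \<in> carrier H \<Longrightarrow> \<alpha> \<one>\<^bsub>K\<^esub> a = a"
  using hom_one[OF \<alpha>_hom K.is_group group_BijGroup] by (simp add: BijGroup_def)

lemma inv_\<alpha>_mult:
  assumes "u \<in> carrier K" "v \<in> carrier K" "a \<in> carrier H"
  shows "inv_into (carrier H) (\<alpha> (u \<otimes>\<^bsub>K\<^esub> v)) a
    = inv_into (carrier H) (\<alpha> v) (inv_into (carrier H) (\<alpha> u) a)"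
  using assms by (intro inv_\<alpha>_eqI) (simp_all add: \<alpha>_mult)

lemma inv_\<alpha>_one [simp]: "a \<in> carrier H \<Longrightarrow> inv_into (carrier H) (\<alpha> \<one>\<^bsub>K\<^esub>) a = a"
  by (intro inv_\<alpha>_eqI) simp_all

text \<open>This is \<open>\<alpha>_compat\<close> at \<open>\<alpha> u a\<close>, where the inverse
  cancels.\<close>

lemma \<alpha>_distrib:
  assumes "u \<in> carrier K" "a \<in> carrier H" "b \<in> carrier H"
  shows "\<alpha> u (a \<otimes>\<^bsub>H\<^esub> b) = \<alpha> u a \<otimes>\<^bsub>H\<^esub> \<alpha> (inv_into (carrier K) (\<beta> (\<alpha> u a)) u) b"
  using assms \<alpha>_compat[of "\<alpha> u a" b u] by simp

end

section \<open>The cocycle rule and associativity\<close>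

text \<open>Reopened because an interpretation does not see facts of its context proved after it.\<close>

context matched_product_system
begin

interpretation swap: matched_product_system K H \<beta> \<alpha>
  by (rule matched_product_system_swap)

lemma \<alpha>_fixes_one [simp]:
  assumes "u \<in> carrier K" shows "\<alpha> u \<one>\<^bsub>H\<^esub> = \<one>\<^bsub>H\<^esub>"
  using assms \<alpha>_compat[of "\<one>\<^bsub>H\<^esub>" "\<one>\<^bsub>H\<^esub>" u] by simp

lemma inv_\<beta>_distrib:
  assumes "c \<in> carrier H" "x \<in> carrier K" "v \<in> carrier K"
  shows "inv_into (carrier K) (\<beta> c) (x \<otimes>\<^bsub>K\<^esub> v)
    = inv_into (carrier K) (\<beta> c) x
      \<otimes>\<^bsub>K\<^esub> inv_into (carrier K) (\<beta> (inv_into (carrier H) (\<alpha> x) c)) v"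
  using assms by (intro swap.inv_\<alpha>_eqI) (simp_all add: \<beta>_compat)

text \<open>The first component of associativity; the second is its mirror image. The work lies in
  simplifying the index of the permutation acting on \<open>c\<close>.\<close>

lemma matched_product_assoc_fst:
  assumes "a \<in> carrier H" "b \<in> carrier H" "c \<in> carrier H" "u \<in> carrier K" "v \<in> carrier K"
  defines "x \<equiv> inv_into (carrier K) (\<beta> a) u"
  shows "a \<otimes>\<^bsub>H\<^esub> \<alpha> x b \<otimes>\<^bsub>H\<^esub>
      \<alpha> (inv_into (carrier K) (\<beta> (a \<otimes>\<^bsub>H\<^esub> \<alpha> x b))
           (u \<otimes>\<^bsub>K\<^esub> \<beta> (inv_into (carrier H) (\<alpha> u) a) v)) c
    = a \<otimes>\<^bsub>H\<^esub> \<alpha> x (b \<otimes>\<^bsub>H\<^esub> \<alpha> (inv_into (carrier K) (\<beta> b) v) c)"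
proof -
  have x: "x \<in> carrier K" using assms by simp
  have "inv_into (carrier K) (\<beta> (a \<otimes>\<^bsub>H\<^esub> \<alpha> x b))
      (u \<otimes>\<^bsub>K\<^esub> \<beta> (inv_into (carrier H) (\<alpha> u) a) v)
    = inv_into (carrier K) (\<beta> (\<alpha> x b))
        (inv_into (carrier K) (\<beta> a) (u \<otimes>\<^bsub>K\<^esub> \<beta> (inv_into (carrier H) (\<alpha> u) a) v))"
    using assms(1-5) x by (simp add: swap.inv_\<alpha>_mult)
  \<comment> \<open>In the cocycle rule the inverse of \<open>\<beta>\<close> at
    \<open>inv_into (carrier H) (\<alpha> u) a\<close> cancels against \<open>\<beta>\<close> at the
    same index.\<close>
  also have "inv_into (carrier K) (\<beta> a) (u \<otimes>\<^bsub>K\<^esub> \<beta> (inv_into (carrier H) (\<alpha> u) a) v)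
    = x \<otimes>\<^bsub>K\<^esub> v"
    using assms by (simp add: inv_\<beta>_distrib)
  also have "inv_into (carrier K) (\<beta> (\<alpha> x b)) (x \<otimes>\<^bsub>K\<^esub> v)
    = inv_into (carrier K) (\<beta> (\<alpha> x b)) x \<otimes>\<^bsub>K\<^esub> inv_into (carrier K) (\<beta> b) v"
    using assms(1-5) x by (simp add: inv_\<beta>_distrib)
  \<comment> \<open>The index is now a product, so \<open>\<alpha>_mult\<close> splits the action on
    \<open>c\<close> into the two steps that \<open>\<alpha>_distrib\<close> produces on the
    right.\<close>
  finally show ?thesis
    using assms(1-5) x by (simp add: \<alpha>_distrib \<alpha>_mult H.m_assoc)
qed

end

section \<open>The matched product is a group\<close>

context matched_product_system
begin

interpretation swap: matched_product_system K H \<beta> \<alpha>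
  by (rule matched_product_system_swap)

lemma monoid_matched_product: "monoid (matched_product H K \<alpha> \<beta>)"
  by (rule monoidI)
    (auto simp: matched_product_def matched_product_assoc_fst swap.matched_product_assoc_fst)

lemma matched_product_r_inv_ex:
  assumes "x \<in> carrier (matched_product H K \<alpha> \<beta>)"
  shows "\<exists>y \<in> carrier (matched_product H K \<alpha> \<beta>).
    x \<otimes>\<^bsub>matched_product H K \<alpha> \<beta>\<^esub> y = \<one>\<^bsub>matched_product H K \<alpha> \<beta>\<^esub>"
proof -
  obtain a u where x: "x = (a, u)" and au: "a \<in> carrier H" "u \<in> carrier K"
    using assms by (auto simp: matched_product_def)
  \<comment> \<open>Each component of \<open>x \<otimes> y = \<one>\<close> contains only one
    unknown, under a permutation that can be inverted.\<close>
  define b where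
    "b = inv_into (carrier H) (\<alpha> (inv_into (carrier K) (\<beta> a) u)) (inv\<^bsub>H\<^esub> a)"
  define v where
    "v = inv_into (carrier K) (\<beta> (inv_into (carrier H) (\<alpha> u) a)) (inv\<^bsub>K\<^esub> u)"
  show ?thesis
    using au by (intro bexI[of _ "(b, v)"]) (simp_all add: x b_def v_def matched_product_def)
qed

lemma group_matched_product: "group (matched_product H K \<alpha> \<beta>)"
proof -
  interpret M: monoid "matched_product H K \<alpha> \<beta>"
    by (rule monoid_matched_product)
  show ?thesis
  proof (rule M.group_l_invI)
    fix x assume x: "x \<in> carrier (matched_product H K \<alpha> \<beta>)"
    obtain y where y: "y \<in> carrier (matched_product H K \<alpha> \<beta>)"
      "x \<otimes>\<^bsub>matched_product H K \<alpha> \<beta>\<^esub> y = \<one>\<^bsub>matched_product H K \<alpha> \<beta>\<^esub>"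
      using matched_product_r_inv_ex x by blast
    obtain z where z: "z \<in> carrier (matched_product H K \<alpha> \<beta>)"
      "y \<otimes>\<^bsub>matched_product H K \<alpha> \<beta>\<^esub> z = \<one>\<^bsub>matched_product H K \<alpha> \<beta>\<^esub>"
      using matched_product_r_inv_ex y by blast
    \<comment> \<open>\<open>y\<close> has left inverse \<open>x\<close> and right inverse
      \<open>z\<close>, so these agree and right inverses are two-sided.\<close>
    have "x = z" using M.inv_unique[OF y(2) z(2)] x y z by simp
    then show "\<exists>y \<in> carrier (matched_product H K \<alpha> \<beta>).
        y \<otimes>\<^bsub>matched_product H K \<alpha> \<beta>\<^esub> x = \<one>\<^bsub>matched_product H K \<alpha> \<beta>\<^esub>"
      using y z by blast
  qed
qed

end

theorem theorem18:
  fixes H :: "('a, 'm) monoid_scheme" and K :: "('b, 'n) monoid_scheme"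
    and \<sigma>S :: "'a \<Rightarrow> 'a \<Rightarrow> 'a" and \<sigma>T :: "'b \<Rightarrow> 'b \<Rightarrow> 'b"
    and \<alpha> :: "'b \<Rightarrow> 'a \<Rightarrow> 'a" and \<beta> :: "'a \<Rightarrow> 'b \<Rightarrow> 'b"
  assumes "affine_structure H \<sigma>S"
    and "affine_structure K \<sigma>T"
    and "matched_product_system H K \<alpha> \<beta>"
    and I_S: "\<And>u. u \<in> carrier K \<Longrightarrow>
      compose (carrier H) (\<sigma>S \<one>\<^bsub>H\<^esub>) (\<alpha> u) = compose (carrier H) (\<alpha> u) (\<sigma>S \<one>\<^bsub>H\<^esub>)"
    and I_T: "\<And>a. a \<in> carrier H \<Longrightarrow>
      compose (carrier K) (\<sigma>T \<one>\<^bsub>K\<^esub>) (\<beta> a) = compose (carrier K) (\<beta> a) (\<sigma>T \<one>\<^bsub>K\<^esub>)"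
    and II_S: "\<And>a u. \<lbrakk>a \<in> carrier H; u \<in> carrier K\<rbrakk> \<Longrightarrow> \<sigma>S (\<alpha> u a) = \<sigma>S a"
    and II_T: "\<And>a u. \<lbrakk>a \<in> carrier H; u \<in> carrier K\<rbrakk> \<Longrightarrow> \<sigma>T (\<beta> a u) = \<sigma>T u"
    and III_S: "\<And>a b u v.
      \<lbrakk>a \<in> carrier H; b \<in> carrier H; u \<in> carrier K; v \<in> carrier K\<rbrakk> \<Longrightarrow>
      compose (carrier H)
        (\<alpha> (inv_into (carrier K) (\<beta> b) v))
        (\<sigma>S (rho H \<sigma>S b (inv\<^bsub>H\<^esub> a)))
      = compose (carrier H)
        (\<sigma>S (rho H \<sigma>S b (inv\<^bsub>H\<^esub> a)))
        (\<alpha> (inv_into (carrier K) (\<beta> (\<sigma>S a b)) (\<sigma>T u v)))"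
    and III_T: "\<And>a b u v.
      \<lbrakk>a \<in> carrier H; b \<in> carrier H; u \<in> carrier K; v \<in> carrier K\<rbrakk> \<Longrightarrow>
      compose (carrier K)
        (\<beta> (inv_into (carrier H) (\<alpha> v) b))
        (\<sigma>T (rho K \<sigma>T v (inv\<^bsub>K\<^esub> u)))
      = compose (carrier K)
        (\<sigma>T (rho K \<sigma>T v (inv\<^bsub>K\<^esub> u)))
        (\<beta> (inv_into (carrier H) (\<alpha> (\<sigma>T u v)) (\<sigma>S a b)))"
  shows "affine_structure (matched_product H K \<alpha> \<beta>) (prod_structure H K \<sigma>S \<sigma>T)"
proof -
  interpret S: affine_structure H \<sigma>S by fact
  interpret T: affine_structure K \<sigma>T by fact
  interpret M: matched_product_system H K \<alpha> \<beta> by fact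
  interpret M': matched_product_system K H \<beta> \<alpha> by (rule M.matched_product_system_swap)
  interpret P: group "matched_product H K \<alpha> \<beta>" by (rule M.group_matched_product)
  have comm_S: "\<sigma>S \<one>\<^bsub>H\<^esub> (\<alpha> u x) = \<alpha> u (\<sigma>S \<one>\<^bsub>H\<^esub> x)"
    if "u \<in> carrier K" "x \<in> carrier H" for u x
    using fun_cong[OF I_S, of u x] that by (simp add: compose_eq)
  have comm_T: "\<sigma>T \<one>\<^bsub>K\<^esub> (\<beta> a x) = \<beta> a (\<sigma>T \<one>\<^bsub>K\<^esub> x)"
    if "a \<in> carrier H" "x \<in> carrier K" for a x
    using fun_cong[OF I_T, of a x] that by (simp add: compose_eq)
  have twist_S: "\<alpha> (inv_into (carrier K) (\<beta> b) v) (\<sigma>S (rho H \<sigma>S b (inv\<^bsub>H\<^esub> a)) x)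
      = \<sigma>S (rho H \<sigma>S b (inv\<^bsub>H\<^esub> a)) (\<alpha> (inv_into (carrier K) (\<beta> (\<sigma>S a b)) (\<sigma>T u v)) x)"
    if "a \<in> carrier H" "b \<in> carrier H" "u \<in> carrier K" "v \<in> carrier K" "x \<in> carrier H"
    for a b u v x
    using fun_cong[OF III_S[OF that(1-4)], of x] that(5) by (simp add: compose_eq)
  have affine_S: "\<sigma>S a (b \<otimes>\<^bsub>H\<^esub> \<alpha> (inv_into (carrier K) (\<beta> b) v) (\<sigma>S b c))
      = \<sigma>S a b \<otimes>\<^bsub>H\<^esub> \<alpha> (inv_into (carrier K) (\<beta> (\<sigma>S a b)) (\<sigma>T u v)) (\<sigma>S (\<sigma>S a b) (\<sigma>S a c))"
    if "a \<in> carrier H" "b \<in> carrier H" "c \<in> carrier H" "u \<in> carrier K" "v \<in> carrier K"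
    for a b c u v
    using that twist_S by (intro S.affine_twisted) (auto simp: comm_S)
  have twist_T: "\<beta> (inv_into (carrier H) (\<alpha> v) b) (\<sigma>T (rho K \<sigma>T v (inv\<^bsub>K\<^esub> u)) x)
      = \<sigma>T (rho K \<sigma>T v (inv\<^bsub>K\<^esub> u)) (\<beta> (inv_into (carrier H) (\<alpha> (\<sigma>T u v)) (\<sigma>S a b)) x)"
    if "a \<in> carrier H" "b \<in> carrier H" "u \<in> carrier K" "v \<in> carrier K" "x \<in> carrier K"
    for a b u v x
    using fun_cong[OF III_T[OF that(1-4)], of x] that(5) by (simp add: compose_eq)
  have affine_T: "\<sigma>T u (v \<otimes>\<^bsub>K\<^esub> \<beta> (inv_into (carrier H) (\<alpha> v) b) (\<sigma>T v w))
      = \<sigma>T u v \<otimes>\<^bsub>K\<^esub> \<beta> (inv_into (carrier H) (\<alpha> (\<sigma>T u v)) (\<sigma>S a b)) (\<sigma>T (\<sigma>T u v) (\<sigma>T u w))"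
    if "a \<in> carrier H" "b \<in> carrier H" "u \<in> carrier K" "v \<in> carrier K" "w \<in> carrier K"
    for a b u v w
    using that twist_T by (intro T.affine_twisted) (auto simp: comm_T)
  show ?thesis
  proof unfold_locales
    show "prod_structure H K \<sigma>S \<sigma>T \<in> carrier (matched_product H K \<alpha> \<beta>) \<rightarrow>
        (carrier (matched_product H K \<alpha> \<beta>) \<rightarrow>\<^sub>E carrier (matched_product H K \<alpha> \<beta>))"
      by (auto simp: matched_product_def prod_structure_def split: if_splits)
  next
    fix x y
    assume "x \<in> carrier (matched_product H K \<alpha> \<beta>)" "y \<in> carrier (matched_product H K \<alpha> \<beta>)"
    then show "prod_structure H K \<sigma>S \<sigma>T (x \<otimes>\<^bsub>matched_product H K \<alpha> \<beta>\<^esub> y) =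
        compose (carrier (matched_product H K \<alpha> \<beta>))
          (prod_structure H K \<sigma>S \<sigma>T y) (prod_structure H K \<sigma>S \<sigma>T x)"
      \<comment> \<open>By (II) the permutations twisting the second factors of the product do not
        change the indexed maps, so the anti-homomorphism rules of the factors apply.\<close>
      by (auto simp: matched_product_def prod_structure_def compose_def
          S.\<sigma>_mult T.\<sigma>_mult II_S II_T)
  next
    fix x y z
    assume "x \<in> carrier (matched_product H K \<alpha> \<beta>)" "y \<in> carrier (matched_product H K \<alpha> \<beta>)"
      "z \<in> carrier (matched_product H K \<alpha> \<beta>)"
    then show "prod_structure H K \<sigma>S \<sigma>T x
          (y \<otimes>\<^bsub>matched_product H K \<alpha> \<beta>\<^esub> prod_structure H K \<sigma>S \<sigma>T y z)
        = prod_structure H K \<sigma>S \<sigma>T x y \<otimes>\<^bsub>matched_product H K \<alpha> \<beta>\<^esub>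
          prod_structure H K \<sigma>S \<sigma>T (prod_structure H K \<sigma>S \<sigma>T x y)
            (prod_structure H K \<sigma>S \<sigma>T x z)"
      by (auto simp: matched_product_def prod_structure_def affine_S affine_T)
  qed
qed

end
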